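(* Let $A_k$ be the current agent with failure rate $Z_k\in(0,1)$. Assume the reward takes values in $[0,1]$ and the user-task distribution does not depend on the agent. Let $T=(\lambda,\delta)$ with $\lambda>0$, $\delta\ge0$ and $\lambda>(1-Z_k)\delta$. Then every modification $c\in\mathcal P_k(T)$ satisfies $$J_{\mathrm{user}}(A_k\oplus c)-J_{\mathrm{user}}(A_k)\ \ge\ \lambda-(1-Z_k)\delta\ >\ 0 .$$ In particular, for $\gamma>0$, setting $\lambda=\lambda_k(\gamma,\delta):=\gamma+(1-Z_k)\delta$ ensures $J_{\mathrm{user}}(A_k\oplus c)-J_{\mathrm{user}}(A_k)\ge\gamma$ for every $c\in\mathcal P_k(T)$.
   Context: $\mathcal T_{\mathrm{user}}$ (user tasks) and $\mathcal O$ (outputs) are measurable spaces. An agent $A$ is a Markov kernel $A(\cdot\mid t)$ from $\mathcal T_{\mathrm{user}}$ to $\mathcal O$. The reward $r:\mathcal T_{\mathrm{user}}\times\mathcal O\to[0,1]$ and failure detector $\phi:\mathcal T_{\mathrm{user}}\times\mathcal O\to\{0,1\}$ are jointly measurable and fixed; $\mathcal D_{\mathrm{user}}$ is a probability measure on $\mathcal T_{\mathrm{user}}$, the same for all agents. Define $V(A,t)=\int r(t,o)A(do\mid t)$, $J_{\mathrm{user}}(A)=\int V(A,t)\,\mathcal D_{\mathrm{user}}(dt)$, $\psi_A(t)=\int\phi(t,o)A(do\mid t)$, $Z_k=\int\psi_{A_k}\,d\mathcal D_{\mathrm{user}}\in(0,1)$, and $$\mathcal D_{F,k}(dt)=\frac{\psi_{A_k}(t)}{Z_k}\mathcal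 D_{\mathrm{user}}(dt),\qquad \mathcal D_{R,k}(dt)=\frac{1-\psi_{A_k}(t)}{1-Z_k}\mathcal D_{\mathrm{user}}(dt).$$ $\mathcal M$ is a set of valid modifications; each $c\in\mathcal M$ yields a candidate agent $A_k\oplus c$. Put $\mathrm{Adv}_{A_k}(\widetilde A,t)=V(\widetilde A,t)-V(A_k,t)$, $L_k(c)=Z_k\,\mathbb E_{t\sim\mathcal D_{F,k}}[\mathrm{Adv}_{A_k}(A_k\oplus c,t)]$, $D_k(c)=\mathbb E_{t\sim\mathcal D_{R,k}}|\mathrm{Adv}_{A_k}(A_k\oplus c,t)|$. For $T=(\lambda,\delta)$ with $\lambda>0,\delta\ge0$, the set of qualified modifications is $\mathcal P_k(T)=\{c\in\mathcal M: L_k(c)\ge\lambda,\ D_k(c)\le\delta\}$. *)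

theory Defs
  imports "HOL-Probability.Probability"
begin

text \<open>
  An agent is a Markov kernel from a measurable space \<open>TS\<close> of user tasks to a measurable space
  \<open>OS\<close> of outputs, i.e. an element of \<open>TS \<rightarrow>\<^sub>M prob_algebra OS\<close>. The argument \<open>A\<close> of
  the definitions below is the current agent; the step index of the agent is only a label and is
  omitted. Likewise \<open>modify A c\<close> is the candidate agent obtained from \<open>A\<close> by the modification \<open>c\<close>.
\<close>

type_synonym ('t, 'o) agent = "'t \<Rightarrow> 'o measure"

definition task_value :: "('t \<times> 'o \<Rightarrow> real) \<Rightarrow> ('t, 'o) agent \<Rightarrow> 't \<Rightarrow> real" where
  "task_value r A t = (\<integral>x. r (t, x) \<partial>A t)"

definition user_value :: "('t \<times> 'o \<Rightarrow> real) \<Rightarrow> 't measure \<Rightarrow> ('t, 'o) agent \<Rightarrow> real" where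
  "user_value r D A = (\<integral>t. task_value r A t \<partial>D)"

definition failure_prob :: "('t \<times> 'o \<Rightarrow> real) \<Rightarrow> ('t, 'o) agent \<Rightarrow> 't \<Rightarrow> real" where
  "failure_prob \<phi> A t = (\<integral>x. \<phi> (t, x) \<partial>A t)"

definition failure_rate :: "('t \<times> 'o \<Rightarrow> real) \<Rightarrow> 't measure \<Rightarrow> ('t, 'o) agent \<Rightarrow> real" where
  "failure_rate \<phi> D A = (\<integral>t. failure_prob \<phi> A t \<partial>D)"

definition failure_dist :: "('t \<times> 'o \<Rightarrow> real) \<Rightarrow> 't measure \<Rightarrow> ('t, 'o) agent \<Rightarrow> 't measure" where
  "failure_dist \<phi> D A =
     density D (\<lambda>t. ennreal (failure_prob \<phi> A t / failure_rate \<phi> D A))"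

definition non_failure_dist :: "('t \<times> 'o \<Rightarrow> real) \<Rightarrow> 't measure \<Rightarrow> ('t, 'o) agent \<Rightarrow> 't measure" where
  "non_failure_dist \<phi> D A =
     density D (\<lambda>t. ennreal ((1 - failure_prob \<phi> A t) / (1 - failure_rate \<phi> D A)))"

definition advantage ::
  "('t \<times> 'o \<Rightarrow> real) \<Rightarrow> ('t, 'o) agent \<Rightarrow> ('t, 'o) agent \<Rightarrow> 't \<Rightarrow> real" where
  "advantage r A B t = task_value r B t - task_value r A t"

definition learning_gain ::
  "('t \<times> 'o \<Rightarrow> real) \<Rightarrow> ('t \<times> 'o \<Rightarrow> real) \<Rightarrow> 't measure \<Rightarrow>
   (('t, 'o) agent \<Rightarrow> 'c \<Rightarrow> ('t, 'o) agent) \<Rightarrow> ('t, 'o) agent \<Rightarrow> 'c \<Rightarrow> real" where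
  "learning_gain r \<phi> D modify A c =
     failure_rate \<phi> D A * (\<integral>t. advantage r A (modify A c) t \<partial>failure_dist \<phi> D A)"

definition non_failure_drift ::
  "('t \<times> 'o \<Rightarrow> real) \<Rightarrow> ('t \<times> 'o \<Rightarrow> real) \<Rightarrow> 't measure \<Rightarrow>
   (('t, 'o) agent \<Rightarrow> 'c \<Rightarrow> ('t, 'o) agent) \<Rightarrow> ('t, 'o) agent \<Rightarrow> 'c \<Rightarrow> real" where
  "non_failure_drift r \<phi> D modify A c =
     (\<integral>t. \<bar>advantage r A (modify A c) t\<bar> \<partial>non_failure_dist \<phi> D A)"

definition qualified_mods ::
  "('t \<times> 'o \<Rightarrow> real) \<Rightarrow> ('t \<times> 'o \<Rightarrow> real) \<Rightarrow> 't measure \<Rightarrow> 'c set \<Rightarrow>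
   (('t, 'o) agent \<Rightarrow> 'c \<Rightarrow> ('t, 'o) agent) \<Rightarrow> ('t, 'o) agent \<Rightarrow> real \<times> real \<Rightarrow> 'c set" where
  "qualified_mods r \<phi> D M modify A T =
     {c \<in> M. learning_gain r \<phi> D modify A c \<ge> fst T \<and>
        non_failure_drift r \<phi> D modify A c \<le> snd T}"

definition gain_threshold ::
  "('t \<times> 'o \<Rightarrow> real) \<Rightarrow> 't measure \<Rightarrow> ('t, 'o) agent \<Rightarrow> real \<Rightarrow> real \<Rightarrow> real" where
  "gain_threshold \<phi> D A \<gamma> \<delta> = \<gamma> + (1 - failure_rate \<phi> D A) * \<delta>"

end

theory Submission
  imports Defs
begin

text \<open>
  Both conditional laws are densities against \<open>D\<close>, with weights \<open>\<psi> / Z\<close> and \<open>(1 - \<psi>) / (1 - Z)\<close>, so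
  the normalisers cancel and the gain splits as the integral of \<open>\<psi> * Adv\<close>, which is the learning
  gain, plus that of \<open>(1 - \<psi>) * Adv\<close>, which is at least minus \<open>(1 - Z)\<close> times the drift.
\<close>

text \<open>The integrand depends on \<open>t\<close> as well as on the kernel. Pushing
  \<open>K t\<close> forward along \<open>Pair t\<close> moves this dependence into a kernel on the
  product space, against which the fixed function \<open>f\<close> is integrated.\<close>

lemma kernel_mean_measurable:
  fixes f :: "'t \<times> 'o \<Rightarrow> real"
  assumes f: "f \<in> borel_measurable (TS \<Otimes>\<^sub>M OS)" and K: "K \<in> TS \<rightarrow>\<^sub>M prob_algebra OS"
  shows "(\<lambda>t. \<integral>x. f (t, x) \<partial>K t) \<in> borel_measurable TS"
proof -
  note f [measurable]
  have [measurable]: "K \<in> TS \<rightarrow>\<^sub>M subprob_algebra OS"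
    using K by (rule measurable_prob_algebraD)
  note integral_measurable_subprob_algebra[measurable] measurable_distr2[measurable]
  have "(\<lambda>t. integral\<^sup>L (distr (K t) (TS \<Otimes>\<^sub>M OS) (Pair t)) f) \<in> borel_measurable TS"
    by measurable
  \<comment> \<open>On the space of \<open>TS\<close> the map \<open>Pair t\<close> is measurable,
    so change of variables turns the pushforward integral back into the one over
    \<open>K t\<close>.\<close>
  then show ?thesis
    by (rule measurable_cong[THEN iffD1, rotated]) (simp add: integral_distr)
qed

text \<open>A mean under a probability measure stays between the bounds of its integrand. This
  serves for the reward and for the failure detector alike.\<close>

lemma kernel_mean_range:
  fixes f :: "'t \<times> 'o \<Rightarrow> real"
  assumes f: "f \<in> borel_measurable (TS \<Otimes>\<^sub>M OS)" and K: "K \<in> TS \<rightarrow>\<^sub>M prob_algebra OS"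
    and range: "\<And>x. x \<in> space OS \<Longrightarrow> f (t, x) \<in> {0..1}" and t: "t \<in> space TS"
  shows "(\<integral>x. f (t, x) \<partial>K t) \<in> {0..1}"
proof -
  have Kt: "K t \<in> space (prob_algebra OS)"
    using K t by (rule measurable_space)
  then interpret prob_space "K t"
    by (simp add: space_prob_algebra)
  have sets: "sets (K t) = sets OS"
    using Kt by (simp add: space_prob_algebra)
  have bounds: "AE x in K t. 0 \<le> f (t, x)" "AE x in K t. f (t, x) \<le> 1"
    using range sets_eq_imp_space_eq[OF sets] by auto
  have "(\<lambda>x. f (t, x)) \<in> borel_measurable (K t)"
    using measurable_compose[OF measurable_Pair1'[OF t] f] sets by (simp cong: measurable_cong_sets)
  then have "integrable (K t) (\<lambda>x. f (t, x))"
    using bounds by (intro integrable_const_bound[where B = 1]) auto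
  then show ?thesis
    using bounds by (auto intro!: integral_ge_const integral_le_const)
qed

text \<open>The factor \<open>z\<close> undoes the normaliser of the density. It is used with
  \<open>w\<close> = \<psi>, \<open>z\<close> = Z for the learning gain and with \<open>w\<close> =
  1 - \<psi>, \<open>z\<close> = 1 - Z for the drift.\<close>

lemma normalized_density_integral:
  fixes w g :: "'t \<Rightarrow> real"
  assumes w: "w \<in> borel_measurable D" and g: "g \<in> borel_measurable D"
    and nonneg: "\<And>t. t \<in> space D \<Longrightarrow> 0 \<le> w t" and z: "0 < z"
  shows "z * (\<integral>t. g t \<partial>density D (\<lambda>t. ennreal (w t / z))) = (\<integral>t. w t * g t \<partial>D)"
proof -
  have "(\<integral>t. g t \<partial>density D (\<lambda>t. ennreal (w t / z))) = (\<integral>t. w t / z * g t \<partial>D)"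
    using w g nonneg z by (subst integral_density) auto
  also have "\<dots> = (\<integral>t. w t * g t \<partial>D) / z"
    by simp
  finally show ?thesis
    using z by simp
qed

text \<open>This is the bound before any thresholds: gain and drift are kept exact, and \<lambda>
  and \<delta> enter later by monotonicity. The detector enters only through its mean, so a range in
  the unit interval suffices.\<close>

lemma user_value_gain:
  fixes r \<phi> :: "'t \<times> 'o \<Rightarrow> real"
  assumes r: "r \<in> borel_measurable (TS \<Otimes>\<^sub>M OS)"
    and r_range: "\<And>t x. t \<in> space TS \<Longrightarrow> x \<in> space OS \<Longrightarrow> r (t, x) \<in> {0..1}"
    and phi: "\<phi> \<in> borel_measurable (TS \<Otimes>\<^sub>M OS)"
    and phi_range: "\<And>t x. t \<in> space TS \<Longrightarrow> x \<in> space OS \<Longrightarrow> \<phi> (t, x) \<in> {0..1}"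
    and D: "prob_space D" and sets: "sets D = sets TS"
    and A: "A \<in> TS \<rightarrow>\<^sub>M prob_algebra OS"
    and B: "modify A c \<in> TS \<rightarrow>\<^sub>M prob_algebra OS"
    and Z: "failure_rate \<phi> D A \<in> {0<..<1}"
  shows "learning_gain r \<phi> D modify A c
      - (1 - failure_rate \<phi> D A) * non_failure_drift r \<phi> D modify A c
    \<le> user_value r D (modify A c) - user_value r D A"
proof -
  interpret prob_space D by (rule D)
  note space = sets_eq_imp_space_eq[OF sets]
  \<comment> \<open>Carries measurability from \<open>TS\<close> over to \<open>D\<close>, which has
    the same sigma-algebra.\<close>
  note borel = measurable_cong_sets[OF sets refl, THEN equalityD2, THEN subsetD]
  define p where "p = failure_prob \<phi> A"
  define adv where "adv = advantage r A (modify A c)"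
  have value_meas: "task_value r K \<in> borel_measurable D"
    and value_range: "\<And>t. t \<in> space D \<Longrightarrow> task_value r K t \<in> {0..1}"
    if "K \<in> TS \<rightarrow>\<^sub>M prob_algebra OS" for K
    using borel[OF kernel_mean_measurable[OF r that]] kernel_mean_range[OF r that r_range] space
    by (simp_all add: task_value_def[abs_def])
  have value_int: "integrable D (task_value r K)" if "K \<in> TS \<rightarrow>\<^sub>M prob_algebra OS" for K
    using value_meas[OF that] value_range[OF that]
    by (intro integrable_const_bound[where B = 1]) auto
  have p_meas [measurable]: "p \<in> borel_measurable D"
    and p_range: "\<And>t. t \<in> space D \<Longrightarrow> p t \<in> {0..1}"
    using borel[OF kernel_mean_measurable[OF phi A]] kernel_mean_range[OF phi A phi_range] space
    by (simp_all add: p_def failure_prob_def[abs_def])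
  have adv_meas [measurable]: "adv \<in> borel_measurable D"
    using value_meas[OF A] value_meas[OF B] by (simp add: adv_def advantage_def[abs_def])
  have adv_bound: "\<bar>adv t\<bar> \<le> 1" if "t \<in> space D" for t
    using value_range[OF A that] value_range[OF B that] by (auto simp: adv_def advantage_def)
  \<comment> \<open>Both weights and the advantage are bounded by 1 in absolute value. On a
    probability space this makes the products integrable, as additivity and monotonicity of the
    integral require.\<close>
  have weighted: "\<bar>p t * adv t\<bar> \<le> 1" "\<bar>(1 - p t) * adv t\<bar> \<le> 1" if "t \<in> space D" for t
    using p_range[OF that] adv_bound[OF that] by (auto simp: abs_mult intro!: mult_le_one)
  have int: "integrable D (\<lambda>t. p t * adv t)" "integrable D (\<lambda>t. (1 - p t) * adv t)"
    using weighted by (auto intro!: integrable_const_bound[where B = 1])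
  have "integrable D (\<lambda>t. (1 - p t) * \<bar>adv t\<bar>)"
    using weighted(2) by (auto intro!: integrable_const_bound[where B = 1] simp: abs_mult)
  \<comment> \<open>The minus sign is moved under the integral; then \<open>adv t\<close> is at
    least its negated absolute value pointwise, and the weight \<open>1 - p t\<close> is
    nonnegative.\<close>
  then have drift: "- (\<integral>t. (1 - p t) * \<bar>adv t\<bar> \<partial>D) \<le> (\<integral>t. (1 - p t) * adv t \<partial>D)"
    unfolding integral_minus[symmetric] using int(2)
  proof (intro integral_mono)
    fix t assume "t \<in> space D"
    with p_range[of t] have "(1 - p t) * (- \<bar>adv t\<bar>) \<le> (1 - p t) * adv t"
      by (intro mult_left_mono) auto
    then show "- ((1 - p t) * \<bar>adv t\<bar>) \<le> (1 - p t) * adv t"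
      by simp
  qed auto
  \<comment> \<open>Both normalisers are positive because Z lies strictly between 0 and 1.\<close>
  have L: "learning_gain r \<phi> D modify A c = (\<integral>t. p t * adv t \<partial>D)"
    unfolding learning_gain_def failure_dist_def p_def[symmetric] adv_def[symmetric]
    using Z p_range by (intro normalized_density_integral) auto
  have R: "(1 - failure_rate \<phi> D A) * non_failure_drift r \<phi> D modify A c
      = (\<integral>t. (1 - p t) * \<bar>adv t\<bar> \<partial>D)"
    unfolding non_failure_drift_def non_failure_dist_def p_def[symmetric] adv_def[symmetric]
    using Z p_range by (intro normalized_density_integral) auto
  have "user_value r D (modify A c) - user_value r D A = (\<integral>t. adv t \<partial>D)"
    using value_int[OF A] value_int[OF B] by (simp add: user_value_def adv_def advantage_def)
  also have "\<dots> = (\<integral>t. p t * adv t + (1 - p t) * adv t \<partial>D)"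
    by (simp add: algebra_simps)
  also have "\<dots> = (\<integral>t. p t * adv t \<partial>D) + (\<integral>t. (1 - p t) * adv t \<partial>D)"
    using int by (rule Bochner_Integration.integral_add)
  finally show ?thesis
    using drift L R by simp
qed

theorem corollary1:
  fixes TS :: "'t measure" and OS :: "'o measure"
    and D :: "'t measure"
    and r \<phi> :: "'t \<times> 'o \<Rightarrow> real"
    and A :: "('t, 'o) agent"
    and M :: "'c set"
    and modify :: "('t, 'o) agent \<Rightarrow> 'c \<Rightarrow> ('t, 'o) agent"
  assumes r_measurable: "r \<in> borel_measurable (TS \<Otimes>\<^sub>M OS)"
    and r_range: "\<And>t x. t \<in> space TS \<Longrightarrow> x \<in> space OS \<Longrightarrow> r (t, x) \<in> {0..1}"
    and phi_measurable: "\<phi> \<in> borel_measurable (TS \<Otimes>\<^sub>M OS)"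
    and phi_range: "\<And>t x. t \<in> space TS \<Longrightarrow> x \<in> space OS \<Longrightarrow> \<phi> (t, x) \<in> {0, 1}"
    and D_prob: "prob_space D"
    and D_sets: "sets D = sets TS"
    and A_kernel: "A \<in> TS \<rightarrow>\<^sub>M prob_algebra OS"
    and modify_kernel: "\<And>c. c \<in> M \<Longrightarrow> modify A c \<in> TS \<rightarrow>\<^sub>M prob_algebra OS"
    and Z_range: "failure_rate \<phi> D A \<in> {0<..<1}"
  shows "(\<forall>l \<delta>. l > 0 \<and> \<delta> \<ge> 0 \<and> l > (1 - failure_rate \<phi> D A) * \<delta> \<longrightarrow>
            (\<forall>c \<in> qualified_mods r \<phi> D M modify A (l, \<delta>).
               user_value r D (modify A c) - user_value r D A \<ge> l - (1 - failure_rate \<phi> D A) * \<delta> \<and>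
               l - (1 - failure_rate \<phi> D A) * \<delta> > 0)) \<and>
         (\<forall>\<gamma> \<delta>. \<gamma> > 0 \<and> \<delta> \<ge> 0 \<longrightarrow>
            (\<forall>c \<in> qualified_mods r \<phi> D M modify A (gain_threshold \<phi> D A \<gamma> \<delta>, \<delta>).
               user_value r D (modify A c) - user_value r D A \<ge> \<gamma>))"
proof -
  let ?Z = "failure_rate \<phi> D A"
  \<comment> \<open>Stated for arbitrary thresholds, so that both conjuncts are instances of
    it.\<close>
  have gain: "l - (1 - ?Z) * \<delta> \<le> user_value r D (modify A c) - user_value r D A"
    if c: "c \<in> qualified_mods r \<phi> D M modify A (l, \<delta>)" for l \<delta> c
  proof -
    have phi_unit: "\<phi> (t, x) \<in> {0..1}" if "t \<in> space TS" "x \<in> space OS" for t x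
      using phi_range[OF that] by auto
    have "modify A c \<in> TS \<rightarrow>\<^sub>M prob_algebra OS"
      using c by (intro modify_kernel) (simp add: qualified_mods_def)
    note user_value_gain[where modify = modify and c = c, OF r_measurable r_range phi_measurable phi_unit D_prob D_sets A_kernel
        this Z_range]
    moreover have "(1 - ?Z) * non_failure_drift r \<phi> D modify A c \<le> (1 - ?Z) * \<delta>"
      using c Z_range by (intro mult_left_mono) (auto simp: qualified_mods_def)
    moreover have "l \<le> learning_gain r \<phi> D modify A c"
      using c by (simp add: qualified_mods_def)
    ultimately show ?thesis
      by linarith
  qed
  show ?thesis
  proof (intro conjI allI impI ballI)
    fix \<gamma> \<delta> c
    assume "c \<in> qualified_mods r \<phi> D M modify A (gain_threshold \<phi> D A \<gamma> \<delta>, \<delta>)"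
    \<comment> \<open>With \<open>l\<close> = \<gamma> + (1 - Z) * \<delta> the drift allowance
      cancels and \<gamma> remains.\<close>
    from gain[OF this] show "\<gamma> \<le> user_value r D (modify A c) - user_value r D A"
      by (simp add: gain_threshold_def)
  qed (use gain in auto)
qed

end
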